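(* For a strict partition $\lambda$, the formula $$Q_\lambda(t^\bullet)=\frac{t^{n(\lambda)}\prod_{(i,j)\in\lambda^*}(1+t^{c_{ij}})}{\prod_{(i,j)\in\lambda^*}(1-t^{h^*_{ij}})}$$ is equivalent to Rosengren's formula $$Q_\lambda(t^\bullet)=\prod_{1\le i\le\ell(\lambda)}\frac{(-1;t)_{\lambda_i}}{(t;t)_{\lambda_i}}\prod_{1\le i<j\le\ell(\lambda)}\frac{t^{\lambda_j}-t^{\lambda_i}}{1-t^{\lambda_i+\lambda_j}},$$ in the sense that the two right-hand sides are equal for every strict partition $\lambda$: $$\frac{t^{n(\lambda)}\prod_{(i,j)\in\lambda^*}(1+t^{c_{ij}})}{\prod_{(i,j)\in\lambda^*}(1-t^{h^*_{ij}})}=\prod_{1\le i\le\ell(\lambda)}\frac{(-1;t)_{\lambda_i}}{(t;t)_{\lambda_i}}\prod_{1\le i<j\le\ell(\lambda)}\frac{t^{\lambda_j}-t^{\lambda_i}}{1-t^{\lambda_i+\lambda_j}}.$$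
   Context: For $k\in\mathbb{N}$, $(a;t)_k=(1-a)(1-at)\cdots(1-at^{k-1})$. A strict partition $\lambda=(\lambda_1>\cdots>\lambda_\ell>0)$ has length $\ell(\lambda)=\ell$, and $n(\lambda)=\sum_{i\ge1}(i-1)\lambda_i$. Its shifted diagram is $\lambda^*=\{(i,j): 1\le i\le\ell(\lambda),\ i\le j\le\lambda_i+i-1\}$. The content of $(i,j)\in\lambda^*$ is $c_{ij}=j-i$. The double partition $\widetilde\lambda$ is the partition with Frobenius notation $(\lambda_1,\dots,\lambda_\ell\,|\,\lambda_1-1,\dots,\lambda_\ell-1)$ (so for $1\le i\le\ell$ it has $\lambda_i$ cells in row $i$ strictly right of $(i,i)$ and $\lambda_i-1$ cells in column $i$ strictly below $(i,i)$). The shifted diagram $\lambda^*$ is identified with the part of $\widetilde\lambda$ strictly above the main diagonal, $(i,j)\in\lambda^*$ corresponding to the cell $(i,j+1)$ of $\widetilde\lambda$; the shifted hook length $h^*_{ij}$ is the ordinary hook length in $\widetilde\lambda$ of that corresponding cell. (Example: for $\lambda=(4,2,1)$ the rows of shifted hook lengths are $6,5,4,1$; $3,2$; $1$.) $Q_\lambda(t^\bullet)=Q_\lambda(1,t,t^2,\ldots)$, where the Schur $Q$-function is the $m\to\infty$ limit of $Q_\lambda(z_1,\dots,z_m)=2^{\ell}\sum_{w\in S_m/S_{m-\ell}}w\big(z_1^{\lambda_1}\cdots z_\ell^{\lambda_\ell}\prod_{1\le i\le\ell}\prod_{i<j\le m}\frac{z_i+z_j}{z_i-z_j}\big)$ ($m\ge\ell$,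 $S_{m-\ell}$ permuting $z_{\ell+1},\dots,z_m$). *)

theory Defs
  imports Complex_Main
begin

text \<open>Strict partitions are strictly decreasing lists of positive integers. Rows, columns and
  parts are numbered from 1, and a diagram is a set of cells (row, column).\<close>

definition strict_partition :: "nat list \<Rightarrow> bool" where
  "strict_partition l \<longleftrightarrow> sorted_wrt (>) l \<and> (\<forall>p\<in>set l. 0 < p)"

text \<open>Only meaningful for \<open>1 \<le> i \<le> length l\<close>.\<close>
definition part :: "nat list \<Rightarrow> nat \<Rightarrow> nat" where
  "part l i = l ! (i - 1)"

definition n_stat :: "nat list \<Rightarrow> nat" where
  "n_stat l = (\<Sum>i=1..length l. (i - 1) * part l i)"

definition shifted_diagram :: "nat list \<Rightarrow> (nat \<times> nat) set" where
  "shifted_diagram l = {(i, j). 1 \<le> i \<and> i \<le> length l \<and> i \<le> j \<and> j \<le> part l i + i - 1}"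

text \<open>Natural-number subtraction is exact on shifted diagrams, where \<open>i \<le> j\<close>.\<close>
definition content :: "nat \<times> nat \<Rightarrow> nat" where
  "content = (\<lambda>(i, j). j - i)"

text \<open>The Young diagram of the partition with Frobenius notation \<open>(as | bs)\<close>, as the union of its
  principal hooks: the hook at \<open>(i, i)\<close> has \<open>part as i\<close> further cells to the right and
  \<open>part bs i\<close> further cells below.\<close>
definition frobenius_diagram :: "nat list \<Rightarrow> nat list \<Rightarrow> (nat \<times> nat) set" where
  "frobenius_diagram as bs =
     {(i, j). 1 \<le> i \<and> i \<le> length as \<and> i \<le> j \<and> j \<le> i + part as i} \<union>
     {(i, j). 1 \<le> j \<and> j \<le> length bs \<and> j \<le> i \<and> i \<le> j + part bs j}"

definition double_diagram :: "nat list \<Rightarrow> (nat \<times> nat) set" where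
  "double_diagram l = frobenius_diagram l (map (\<lambda>p. p - 1) l)"

definition hook_length :: "(nat \<times> nat) set \<Rightarrow> nat \<times> nat \<Rightarrow> nat" where
  "hook_length D = (\<lambda>(i, j). card {j'. j < j' \<and> (i, j') \<in> D} + card {i'. i < i' \<and> (i', j) \<in> D} + 1)"

text \<open>The cell \<open>(i, j)\<close> of the shifted diagram sits at \<open>(i, j + 1)\<close> in the double diagram.\<close>
definition shifted_hook_length :: "nat list \<Rightarrow> nat \<times> nat \<Rightarrow> nat" where
  "shifted_hook_length l = (\<lambda>(i, j). hook_length (double_diagram l) (i, j + 1))"

definition q_pochhammer :: "'a::comm_ring_1 \<Rightarrow> 'a \<Rightarrow> nat \<Rightarrow> 'a" where
  "q_pochhammer a t k = (\<Prod>r<k. 1 - a * t ^ r)"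

end

theory Submission
  imports Defs
begin

text \<open>
  Both sides factor over the rows of the shifted diagram, and the proof compares them row by row.
  The contents of row \<open>i\<close> are \<open>0, \<dots>, \<lambda>\<^sub>i - 1\<close>, so they contribute the Pochhammer product of \<open>-1\<close>
  with \<open>\<lambda>\<^sub>i\<close> factors. Since \<open>n(\<lambda>)\<close> is the sum of \<open>\<lambda>\<^sub>j\<close> over all pairs \<open>i < j\<close>, the power
  \<open>t^n(\<lambda>)\<close> turns each \<open>1 - t^(\<lambda>\<^sub>i - \<lambda>\<^sub>j)\<close> into the numerator \<open>t^\<lambda>\<^sub>j - t^\<lambda>\<^sub>i\<close>. Read in this
  direction the step does not divide by a power of \<open>t\<close>, so \<open>t = 0\<close> is covered.

  What remains is the shifted analogue of a classical fact about hook lengths: the hook lengths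
  of row \<open>i\<close> together with the differences \<open>\<lambda>\<^sub>i - \<lambda>\<^sub>j\<close>, \<open>j > i\<close>, are the
  numbers \<open>1, \<dots>, \<lambda>\<^sub>i\<close> together with the sums \<open>\<lambda>\<^sub>i + \<lambda>\<^sub>j\<close>, \<open>j > i\<close>, as multisets.
  In the double diagram, the cells of the row lying in the columns up to \<open>\<ell>(\<lambda>)\<close> have hooks that
  reach the main diagonal, and the sums are their hook lengths
  (\<open>shifted_hook_length_inner\<close>). The hook of a cell further right stays above the diagonal, and
  the hook lengths of these cells are exactly the numbers in \<open>1, \<dots>, \<lambda>\<^sub>i\<close> that are not
  differences (\<open>shifted_hook_length_outer_bij\<close>).
\<close>

section \<open>Parts of a strict partition\<close>

lemma part_pos:
  assumes "strict_partition l" "1 \<le> i" "i \<le> length l"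
  shows "0 < part l i"
  using assms by (auto simp: strict_partition_def part_def)

lemma part_strict_decreasing:
  assumes "strict_partition l" "1 \<le> i" "i < j" "j \<le> length l"
  shows "part l j < part l i"
proof -
  have "i - 1 < j - 1" "j - 1 < length l" using assms by auto
  then show ?thesis
    using assms(1) unfolding strict_partition_def part_def by (metis sorted_wrt_nth_less)
qed

text \<open>In other words, \<open>i + \<lambda>\<^sub>i\<close> is weakly decreasing: the rows of the shifted diagram end
  further and further left.\<close>
lemma part_gap:
  assumes "strict_partition l" "1 \<le> i" "i \<le> j" "j \<le> length l"
  shows "j + part l j \<le> i + part l i"
  using assms(3,4)
proof (induction j rule: dec_induct)
  case base
  then show ?case by simp
next
  case (step j)
  have "part l (Suc j) < part l j"
    using part_strict_decreasing[of l j "Suc j"] assms(1,2) step by simp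
  then show ?case using step by simp
qed

lemma length_less_part:
  assumes "strict_partition l" "1 \<le> i" "i \<le> length l"
  shows "length l < i + part l i"
  using part_gap[OF assms order_refl] part_pos[OF assms(1), of "length l"] assms by simp

lemma inj_on_part_differences:
  assumes "strict_partition l" "1 \<le> i"
  shows "inj_on (\<lambda>k. part l i - part l k) {i<..length l}"
proof (intro linorder_inj_onI)
  fix x y assume "x < y" "x \<in> {i<..length l}" "y \<in> {i<..length l}"
  then show "part l i - part l x \<noteq> part l i - part l y"
    using part_strict_decreasing[OF assms(1), of x y]
      part_strict_decreasing[OF assms, of x] part_strict_decreasing[OF assms, of y] assms(2)
    by simp
qed auto

section \<open>Hook lengths in a row\<close>

lemma double_diagram_iff:
  "(i, j) \<in> double_diagram l \<longleftrightarrow>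
     (1 \<le> i \<and> i \<le> length l \<and> i \<le> j \<and> j \<le> i + part l i) \<or>
     (1 \<le> j \<and> j \<le> length l \<and> j \<le> i \<and> i \<le> j + (part l j - 1))"
  unfolding double_diagram_def frobenius_diagram_def part_def by auto

lemma shifted_arm:
  assumes "1 \<le> i" "i \<le> length l" "i \<le> j"
  shows "card {j'. j + 1 < j' \<and> (i, j') \<in> double_diagram l} = i + part l i - (j + 1)"
proof -
  have "{j'. j + 1 < j' \<and> (i, j') \<in> double_diagram l} = {j + 1<..i + part l i}"
    using assms by (auto simp: double_diagram_iff)
  then show ?thesis by simp
qed

text \<open>Column \<open>j + 1 \<le> \<ell>(\<lambda>)\<close> of the double diagram is filled without a gap from row \<open>i\<close> down
  to the end of the principal hook at \<open>(j + 1, j + 1)\<close>; hence arm and leg add up to a sum of two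
  parts.\<close>
lemma shifted_hook_length_inner:
  assumes "strict_partition l" "1 \<le> i" "i \<le> j" "j < length l"
  shows "shifted_hook_length l (i, j) = part l i + part l (j + 1)"
proof -
  have pos: "0 < part l (j + 1)" using part_pos[OF assms(1)] assms by simp
  have "{i'. i < i' \<and> (i', j + 1) \<in> double_diagram l} = {i<..j + part l (j + 1)}"
    (is "?L = ?R")
  proof (intro set_eqI iffI)
    fix k assume "k \<in> ?L"
    then show "k \<in> ?R" using assms pos by (auto simp: double_diagram_iff)
  next
    fix k assume k: "k \<in> ?R"
    show "k \<in> ?L"
    proof (cases "k \<le> j + 1")
      case True
      then show ?thesis
        using part_gap[OF assms(1), of k "j + 1"] k assms by (auto simp: double_diagram_iff)
    next
      case False
      then show ?thesis using k assms by (auto simp: double_diagram_iff)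
    qed
  qed
  moreover have "length l < i + part l i" using length_less_part assms by simp
  ultimately show ?thesis
    using shifted_arm[of i l j] assms pos
    by (simp add: shifted_hook_length_def hook_length_def)
qed

text \<open>The leg of a cell beyond column \<open>\<ell>(\<lambda>)\<close> of the double diagram.\<close>
definition outer_leg :: "nat list \<Rightarrow> nat \<Rightarrow> nat \<Rightarrow> nat" where
  "outer_leg l i j = card {k. i < k \<and> k \<le> length l \<and> j < k + part l k}"

lemma shifted_hook_length_outer:
  assumes "1 \<le> i" "i \<le> length l" "length l \<le> j" "j < i + part l i"
  shows "shifted_hook_length l (i, j) = i + part l i - j + outer_leg l i j"
proof -
  have "{i'. i < i' \<and> (i', j + 1) \<in> double_diagram l} =
        {k. i < k \<and> k \<le> length l \<and> j < k + part l k}"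
    using assms by (auto simp: double_diagram_iff)
  then show ?thesis
    using shifted_arm[of i l j] assms
    by (simp add: shifted_hook_length_def hook_length_def outer_leg_def)
qed

text \<open>By \<open>part_gap\<close> the rows below row \<open>i\<close> that meet a given column are consecutive, so
  counting them tells which ones they are.\<close>
lemma less_row_end_iff_outer_leg:
  assumes "strict_partition l" "1 \<le> i" "i < k" "k \<le> length l"
  shows "j < k + part l k \<longleftrightarrow> k \<le> i + outer_leg l i j"
proof -
  define S where "S = {k. i < k \<and> k \<le> length l \<and> j < k + part l k}"
  have fin: "finite S" unfolding S_def by (rule finite_subset[of _ "{..length l}"]) auto
  show ?thesis
  proof (cases "j < k + part l k")
    case True
    have "{i<..k} \<subseteq> S"
    proof
      fix x assume "x \<in> {i<..k}"
      then show "x \<in> S"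
        using part_gap[OF assms(1), of x k] True assms by (auto simp: S_def)
    qed
    then have "card {i<..k} \<le> card S" using fin by (rule card_mono[rotated])
    then show ?thesis using True by (simp add: outer_leg_def S_def)
  next
    case False
    have "S \<subseteq> {i<..<k}"
    proof
      fix x assume x: "x \<in> S"
      have "x < k"
      proof (rule ccontr)
        assume "\<not> x < k"
        then show False
          using part_gap[OF assms(1), of k x] x False assms by (auto simp: S_def)
      qed
      then show "x \<in> {i<..<k}" using x by (simp add: S_def)
    qed
    then have "card S \<le> card {i<..<k}" by (intro card_mono) auto
    then show ?thesis using False assms by (simp add: outer_leg_def S_def)
  qed
qed

lemma outer_leg_le: "outer_leg l i j \<le> length l - i"
proof -
  have "outer_leg l i j \<le> card {i<..length l}"
    unfolding outer_leg_def by (intro card_mono) auto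
  then show ?thesis by simp
qed

lemma outer_leg_antimono:
  assumes "j \<le> j'"
  shows "outer_leg l i j' \<le> outer_leg l i j"
  unfolding outer_leg_def
proof (rule card_mono)
  show "finite {k. i < k \<and> k \<le> length l \<and> j < k + part l k}"
    by (rule finite_subset[of _ "{..length l}"]) auto
qed (use assms in auto)

text \<open>Along the row arm lengths strictly decrease and legs weakly decrease, so these hook lengths
  are distinct. If one of them were a difference \<open>\<lambda>\<^sub>i - \<lambda>\<^sub>k\<close>, the leg would reach row \<open>k\<close>
  exactly when it does not: solving for \<open>j\<close> gives \<open>j = i + m + \<lambda>\<^sub>k\<close> with \<open>m\<close> the leg, so row
  \<open>k\<close> meets the column iff \<open>i + m < k\<close>, whereas the leg consists of the rows up to \<open>i + m\<close>.
  There are as many of these hook lengths as non-differences, so they exhaust those.\<close>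
lemma shifted_hook_length_outer_bij:
  assumes "strict_partition l" "1 \<le> i" "i \<le> length l"
  shows "bij_betw (\<lambda>j. shifted_hook_length l (i, j)) {length l..<i + part l i}
           ({1..part l i} - (\<lambda>k. part l i - part l k) ` {i<..length l})"
proof -
  let ?n = "length l" and ?a = "part l"
  let ?A = "{?n..<i + ?a i}"
  let ?h = "\<lambda>j. shifted_hook_length l (i, j)"
  let ?D = "(\<lambda>k. ?a i - ?a k) ` {i<..?n}"
  have h: "?h j = i + ?a i - j + outer_leg l i j" if "j \<in> ?A" for j
    using shifted_hook_length_outer assms that by simp
  have n_less: "?n < i + ?a i" using length_less_part[OF assms] .
  have a_less: "?a k < ?a i" if "k \<in> {i<..?n}" for k
    using part_strict_decreasing assms that by simp
  have "?h j' < ?h j" if "j \<in> ?A" "j' \<in> ?A" "j < j'" for j j'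
    using h[OF that(1)] h[OF that(2)] outer_leg_antimono[of j j' l i] that by simp
  then have inj: "inj_on ?h ?A"
    by (intro linorder_inj_onI) (auto simp: neq_iff)
  have sub: "?h ` ?A \<subseteq> {1..?a i} - ?D"
  proof
    fix y assume "y \<in> ?h ` ?A"
    then obtain j where j: "j \<in> ?A" and y: "y = i + ?a i - j + outer_leg l i j"
      using h by auto
    have "y \<notin> ?D"
    proof
      assume "y \<in> ?D"
      then obtain k where k: "k \<in> {i<..?n}" and yk: "y = ?a i - ?a k" by auto
      have "j < k + ?a k \<longleftrightarrow> k \<le> i + outer_leg l i j"
        using less_row_end_iff_outer_leg assms k by simp
      moreover have "j = i + outer_leg l i j + ?a k"
        using y yk a_less[OF k] j by simp
      ultimately show False by linarith
    qed
    moreover have "1 \<le> y" "y \<le> ?a i"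
      using y j outer_leg_le[of l i j] assms by auto
    ultimately show "y \<in> {1..?a i} - ?D" by simp
  qed
  have "card ?D = ?n - i"
    using inj_on_part_differences[OF assms(1,2)] by (simp add: card_image)
  moreover have "?D \<subseteq> {1..?a i}"
    using a_less by (fastforce simp: Suc_le_eq)
  ultimately have "card ({1..?a i} - ?D) = ?a i - (?n - i)"
    by (simp add: card_Diff_subset)
  moreover have "card (?h ` ?A) = i + ?a i - ?n"
    using inj by (simp add: card_image)
  ultimately have "card (?h ` ?A) = card ({1..?a i} - ?D)"
    using n_less assms by linarith
  then have "?h ` ?A = {1..?a i} - ?D"
    by (intro card_subset_eq[OF _ sub] finite_Diff finite_atLeastAtMost)
  then show ?thesis using inj by (simp add: bij_betw_def)
qed

text \<open>The hook lengths of a row and the differences are, as a multiset, the numbers up to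
  \<open>\<lambda>\<^sub>i\<close> and the sums. The multisets enter only through products, so an arbitrary weight \<open>f\<close>
  in a commutative monoid expresses this.\<close>
lemma prod_row_hook_lengths:
  fixes f :: "nat \<Rightarrow> 'a::comm_monoid_mult"
  assumes "strict_partition l" "1 \<le> i" "i \<le> length l"
  shows "(\<Prod>j\<in>{i..<i + part l i}. f (shifted_hook_length l (i, j)))
           * (\<Prod>k\<in>{i<..length l}. f (part l i - part l k))
       = (\<Prod>r\<in>{1..part l i}. f r) * (\<Prod>k\<in>{i<..length l}. f (part l i + part l k))"
proof -
  let ?n = "length l" and ?a = "part l"
  let ?d = "\<lambda>k. ?a i - ?a k"
  have a_less: "?a k < ?a i" if "k \<in> {i<..?n}" for k
    using part_strict_decreasing assms that by simp
  have "(\<Prod>j\<in>{i..<i + ?a i}. f (shifted_hook_length l (i, j)))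
      = (\<Prod>j\<in>{i..<?n}. f (shifted_hook_length l (i, j)))
        * (\<Prod>j\<in>{?n..<i + ?a i}. f (shifted_hook_length l (i, j)))"
    using length_less_part[OF assms] assms
    by (intro prod.atLeastLessThan_concat[symmetric]) auto
  also have "(\<Prod>j\<in>{i..<?n}. f (shifted_hook_length l (i, j)))
      = (\<Prod>j\<in>{i..<?n}. f (?a i + ?a (Suc j)))"
    using shifted_hook_length_inner[OF assms(1,2)] by (intro prod.cong) auto
  also have "\<dots> = (\<Prod>k\<in>{i<..?n}. f (?a i + ?a k))"
    by (rule prod.reindex_bij_witness[of _ "\<lambda>k. k - 1" Suc]) auto
  also have "(\<Prod>j\<in>{?n..<i + ?a i}. f (shifted_hook_length l (i, j)))
      = prod f ({1..?a i} - ?d ` {i<..?n})"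
    using prod.reindex_bij_betw[OF shifted_hook_length_outer_bij[OF assms]] .
  finally have row: "(\<Prod>j\<in>{i..<i + ?a i}. f (shifted_hook_length l (i, j)))
      = (\<Prod>k\<in>{i<..?n}. f (?a i + ?a k)) * prod f ({1..?a i} - ?d ` {i<..?n})" .
  have "(\<Prod>k\<in>{i<..?n}. f (?d k)) = prod f (?d ` {i<..?n})"
    using inj_on_part_differences[OF assms(1,2)] by (simp add: prod.reindex)
  moreover have "?d ` {i<..?n} \<subseteq> {1..?a i}"
    using a_less by (fastforce simp: Suc_le_eq)
  then have "prod f {1..?a i} = prod f ({1..?a i} - ?d ` {i<..?n}) * prod f (?d ` {i<..?n})"
    by (intro prod.subset_diff) auto
  ultimately show ?thesis using row by (simp only: mult_ac)
qed

section \<open>Collecting the rows\<close>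

lemma shifted_diagram_Sigma:
  "shifted_diagram l = (SIGMA i:{1..length l}. {i..<i + part l i})"
  unfolding shifted_diagram_def by auto

lemma prod_shifted_diagram:
  "(\<Prod>c\<in>shifted_diagram l. f c) = (\<Prod>i=1..length l. \<Prod>j\<in>{i..<i + part l i}. f (i, j))"
  unfolding shifted_diagram_Sigma by (subst prod.Sigma) auto

lemma n_stat_pairs: "n_stat l = (\<Sum>i=1..length l. \<Sum>j\<in>{i<..length l}. part l j)"
proof -
  have "n_stat l = (\<Sum>j=1..length l. \<Sum>i\<in>{i\<in>{1..length l}. i < j}. part l j)"
    unfolding n_stat_def
  proof (intro sum.cong refl)
    fix j assume "j \<in> {1..length l}"
    then have "{i\<in>{1..length l}. i < j} = {1..<j}" by auto
    then show "(j - 1) * part l j = (\<Sum>i\<in>{i\<in>{1..length l}. i < j}. part l j)" by simp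
  qed
  also have "\<dots> = (\<Sum>i=1..length l. \<Sum>j\<in>{j\<in>{1..length l}. i < j}. part l j)"
    by (rule sum.swap_restrict) auto
  also have "\<dots> = (\<Sum>i=1..length l. \<Sum>j\<in>{i<..length l}. part l j)"
    by (intro sum.cong) auto
  finally show ?thesis .
qed

lemma prod_row_contents:
  fixes t :: "'a::comm_ring_1"
  shows "(\<Prod>j\<in>{i..<i + a}. 1 + t ^ content (i, j)) = q_pochhammer (-1) t a"
  unfolding q_pochhammer_def content_def
  by (rule prod.reindex_bij_witness[of _ "\<lambda>r. r + i" "\<lambda>j. j - i"]) auto

lemma q_pochhammer_diag:
  fixes t :: "'a::comm_ring_1"
  shows "q_pochhammer t t a = (\<Prod>r\<in>{1..a}. 1 - t ^ r)"
  unfolding q_pochhammer_def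
  by (rule prod.reindex_bij_witness[of _ "\<lambda>r. r - 1" Suc]) auto

theorem proposition2p5:
  fixes t :: "'a::field" and l :: "nat list"
  assumes "strict_partition l"
    and "\<And>k. 0 < k \<Longrightarrow> t ^ k \<noteq> 1"
  shows "t ^ n_stat l * (\<Prod>c\<in>shifted_diagram l. 1 + t ^ content c)
           / (\<Prod>c\<in>shifted_diagram l. 1 - t ^ shifted_hook_length l c)
       = (\<Prod>i=1..length l. q_pochhammer (-1) t (part l i) / q_pochhammer t t (part l i))
         * (\<Prod>(i, j)\<in>{(i, j). 1 \<le> i \<and> i < j \<and> j \<le> length l}.
              (t ^ part l j - t ^ part l i) / (1 - t ^ (part l i + part l j)))"
proof -
  let ?n = "length l" and ?a = "part l"
  define C where "C i = q_pochhammer (-1) t (?a i)" for i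
  define P where "P i = q_pochhammer t t (?a i)" for i
  define H where "H i = (\<Prod>j\<in>{i..<i + ?a i}. 1 - t ^ shifted_hook_length l (i, j))" for i
  define D where "D i = (\<Prod>j\<in>{i<..?n}. 1 - t ^ (?a i - ?a j))" for i
  define E where "E i = (\<Prod>j\<in>{i<..?n}. 1 - t ^ (?a i + ?a j))" for i
  define T where "T i = (\<Prod>j\<in>{i<..?n}. t ^ ?a j)" for i
  have row: "T i * C i / H i = C i / P i * (T i * D i / E i)" if i: "i \<in> {1..?n}" for i
  proof -
    have hook: "H i * D i = P i * E i"
      using prod_row_hook_lengths[OF assms(1), of i "\<lambda>k. 1 - t ^ k"] i
      by (simp add: H_def D_def P_def E_def q_pochhammer_diag)
    moreover have "P i \<noteq> 0"
    proof -
      have "1 - t ^ r \<noteq> 0" if "r \<in> {1..?a i}" for r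
        using assms(2)[of r] that by simp
      then show ?thesis unfolding P_def q_pochhammer_diag by (simp add: prod_zero_iff)
    qed
    moreover have "E i \<noteq> 0"
    proof -
      have "t ^ (?a i + ?a j) \<noteq> 1" for j
        using assms(2) part_pos[OF assms(1), of i] i by simp
      then show ?thesis unfolding E_def by simp
    qed
    ultimately have "H i \<noteq> 0" and "P i * E i \<noteq> 0"
      by auto
    moreover have "T i * C i * (P i * E i) = C i * (T i * D i) * H i"
      unfolding hook[symmetric] by (simp only: mult_ac)
    ultimately show ?thesis
      by (simp only: times_divide_times_eq frac_eq_eq not_False_eq_True)
  qed
  have pairs: "{(i, j). 1 \<le> i \<and> i < j \<and> j \<le> ?n} = (SIGMA i:{1..?n}. {i<..?n})"
    by auto
  have "(\<Prod>(i, j)\<in>{(i, j). 1 \<le> i \<and> i < j \<and> j \<le> ?n}.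
              (t ^ ?a j - t ^ ?a i) / (1 - t ^ (?a i + ?a j)))
      = (\<Prod>i=1..?n. \<Prod>j\<in>{i<..?n}. (t ^ ?a j - t ^ ?a i) / (1 - t ^ (?a i + ?a j)))"
    unfolding pairs by (subst prod.Sigma) auto
  also have "\<dots> = (\<Prod>i=1..?n. T i * D i / E i)"
  proof (intro prod.cong refl)
    fix i assume i: "i \<in> {1..?n}"
    have "t ^ ?a j - t ^ ?a i = t ^ ?a j * (1 - t ^ (?a i - ?a j))" if "j \<in> {i<..?n}" for j
    proof -
      have "?a j < ?a i" using part_strict_decreasing assms(1) i that by simp
      then show ?thesis by (simp add: right_diff_distrib flip: power_add)
    qed
    then show "(\<Prod>j\<in>{i<..?n}. (t ^ ?a j - t ^ ?a i) / (1 - t ^ (?a i + ?a j)))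
        = T i * D i / E i"
      by (simp add: T_def D_def E_def prod_dividef prod.distrib)
  qed
  finally have rhs: "(\<Prod>(i, j)\<in>{(i, j). 1 \<le> i \<and> i < j \<and> j \<le> ?n}.
              (t ^ ?a j - t ^ ?a i) / (1 - t ^ (?a i + ?a j)))
      = (\<Prod>i=1..?n. T i * D i / E i)" .
  have "t ^ n_stat l * (\<Prod>c\<in>shifted_diagram l. 1 + t ^ content c)
           / (\<Prod>c\<in>shifted_diagram l. 1 - t ^ shifted_hook_length l c)
      = (\<Prod>i=1..?n. T i * C i / H i)"
    unfolding n_stat_pairs prod_shifted_diagram prod_row_contents
    by (simp add: power_sum T_def C_def H_def prod_dividef prod.distrib)
  also have "\<dots> = (\<Prod>i=1..?n. C i / P i) * (\<Prod>i=1..?n. T i * D i / E i)"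
    unfolding prod.distrib[symmetric] using row by (intro prod.cong) auto
  finally show ?thesis
    unfolding rhs by (simp add: C_def P_def)
qed

end
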